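(* Let $f:[a,b]\to\mathbb{R}$ be Sequential Henstock integrable on $[a,b]$ and let $F(x)=\int_a^x f$ for each $x\in[a,b]$. If $f$ is continuous on $[a,b]$, then $F$ is differentiable at every $x\in[a,b]$ with $F'(x)=f(x)$.
   Context: Derivatives at the endpoints $a,b$ are one-sided, and $\int_a^a f=0$. For a compact interval $I=[p,q]\subset\mathbb{R}$ with $p<q$: a tagged partition $P=\{([x_{i-1},x_i],t_i)\}_{i=1}^k$ of $I$ consists of points $p=x_0<x_1<\dots<x_k=q$ together with tags $t_i\in[x_{i-1},x_i]$. Its Riemann sum for $f$ is $S(f,P)=\sum_{i=1}^k f(t_i)(x_i-x_{i-1})$. A gauge on $I$ is a function $\delta:I\to\mathbb{R}$ with $\delta(x)>0$ for all $x\in I$. $P$ is $\delta(x)$-fine if $x_i-x_{i-1}<\delta(t_i)$ for every $i$. $f$ is Sequential Henstock integrable on $I$ with integral $A=\int_I f=\int_p^q f\in\mathbb{R}$ if there is a sequence of gauges $\{\delta_n\}_{n=1}^\infty$ on $I$ such that, whenever $P_n$ is a $\delta_n(x)$-fine tagged partition of $I$ for each $n$, one has $S(f,P_n)\to A$ as $n\to\infty$. The value of the integral is unique, and a function Sequential Henstock integrable on $[a,b]$ is Sequential Henstock integrable on every compact subinterval, so $F$ is well defined. *)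

theory Defs
  imports Complex_Main
begin

text \<open>A triple (k, x, t) of a number of subintervals, division points x 0, ..., x k and tags
  t 1, ..., t k. Values of x and t at other indices are irrelevant.\<close>

type_synonym tagged_part = "nat \<times> (nat \<Rightarrow> real) \<times> (nat \<Rightarrow> real)"

definition tagged_partition_on :: "real \<Rightarrow> real \<Rightarrow> tagged_part \<Rightarrow> bool" where
  "tagged_partition_on p q = (\<lambda>(k, x, t).
     x 0 = p \<and> x k = q \<and> (\<forall>i\<in>{1..k}. x (i - 1) < x i \<and> t i \<in> {x (i - 1)..x i}))"

definition riemann_sum :: "(real \<Rightarrow> real) \<Rightarrow> tagged_part \<Rightarrow> real" where
  "riemann_sum f = (\<lambda>(k, x, t). \<Sum>i=1..k. f (t i) * (x i - x (i - 1)))"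

definition gauge_on :: "real \<Rightarrow> real \<Rightarrow> (real \<Rightarrow> real) \<Rightarrow> bool" where
  "gauge_on p q \<delta> \<longleftrightarrow> (\<forall>x\<in>{p..q}. \<delta> x > 0)"

definition fine_partition :: "(real \<Rightarrow> real) \<Rightarrow> tagged_part \<Rightarrow> bool" where
  "fine_partition \<delta> = (\<lambda>(k, x, t). \<forall>i\<in>{1..k}. x i - x (i - 1) < \<delta> (t i))"

definition has_sh_integral :: "(real \<Rightarrow> real) \<Rightarrow> real \<Rightarrow> real \<Rightarrow> real \<Rightarrow> bool" where
  "has_sh_integral f A p q \<longleftrightarrow>
     (\<exists>\<delta> :: nat \<Rightarrow> real \<Rightarrow> real. (\<forall>n. gauge_on p q (\<delta> n)) \<and>
       (\<forall>P. (\<forall>n. tagged_partition_on p q (P n) \<and> fine_partition (\<delta> n) (P n)) \<longrightarrow>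
            (\<lambda>n. riemann_sum f (P n)) \<longlonglongrightarrow> A))"

definition sh_integrable_on :: "(real \<Rightarrow> real) \<Rightarrow> real \<Rightarrow> real \<Rightarrow> bool" where
  "sh_integrable_on f p q \<longleftrightarrow> (\<exists>A. has_sh_integral f A p q)"

text \<open>Only meaningful for p \<le> q; for p < q the value is unique because fine partitions exist
  for every gauge. For p > q there are no tagged partitions at all.\<close>

definition sh_integral :: "(real \<Rightarrow> real) \<Rightarrow> real \<Rightarrow> real \<Rightarrow> real" where
  "sh_integral f p q = (if p = q then 0 else (THE A. has_sh_integral f A p q))"

end

theory Submission
  imports Defs "HOL-Analysis.Analysis"
begin

text \<open>
  A continuous \<open>f\<close> on \<open>[a,b]\<close> has an antiderivative \<open>g\<close>, so it suffices to show
  \<open>F x = g x - g a\<close>. The Sequential Henstock integral of any derivative is the increment of its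
  primitive (\<open>has_sh_integral_of_derivative\<close>): differentiability at a tag \<open>t\<close> says exactly that, on short
  intervals around \<open>t\<close>, the term \<open>f t * (v - u)\<close> differs from the increment \<open>g v - g u\<close> by at most
  \<open>\<epsilon> * (v - u)\<close>, and a gauge may encode how short is short enough at each \<open>t\<close>. Summing the errors
  over a fine partition gives at most \<open>\<epsilon>\<close> times the length of the interval, while the increments
  telescope.

  The integral is defined by definite description, so its value is determined only once at most one
  number qualifies (\<open>has_sh_integral_unique\<close>). This rests on Cousin's lemma
  (\<open>fine_tagged_partition_exists\<close>): a partition fine for the minimum of two gauges is fine for both,
  and its Riemann sums must approach both candidate values.
\<close>

section \<open>Existence of fine partitions\<close>

lemma tagged_partition_points:
  assumes "tagged_partition_on p q (k, x, t)" and "i \<le> k"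
  shows "x i \<in> {p..q}"
proof -
  have step: "x j \<le> x (Suc j)" if "j < k" for j
  proof -
    have "Suc j \<in> {1..k}"
      using that by simp
    then show ?thesis
      using assms(1) unfolding tagged_partition_on_def by fastforce
  qed
  have "x 0 \<le> x i"
    using \<open>i \<le> k\<close> by (induction i) (auto intro: order_trans[OF _ step])
  moreover have "x i \<le> x k"
    using \<open>i \<le> k\<close> by (induction i rule: inc_induct) (auto intro: order_trans[OF step])
  ultimately show ?thesis
    using assms(1) by (simp add: tagged_partition_on_def)
qed

lemma fine_tagged_partition_join:
  assumes P: "tagged_partition_on u v (k, x, t)" "fine_partition \<delta> (k, x, t)"
    and Q: "tagged_partition_on v w (l, y, s)" "fine_partition \<delta> (l, y, s)"
  shows "\<exists>R. tagged_partition_on u w R \<and> fine_partition \<delta> R"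
proof -
  define z where "z i = (if i \<le> k then x i else y (i - k))" for i
  define r where "r i = (if i \<le> k then t i else s (i - k))" for i
  have left: "z (i - 1) = x (i - 1) \<and> z i = x i \<and> r i = t i" if "i \<in> {1..k}" for i
    using that by (auto simp: z_def r_def)
  \<comment> \<open>At \<open>i = k + 1\<close> the left endpoint is \<open>x k\<close>, which agrees with \<open>y 0\<close>.\<close>
  have right: "z (i - 1) = y (i - k - 1) \<and> z i = y (i - k) \<and> r i = s (i - k)"
    if "i \<in> {k+1..k+l}" for i
  proof (cases "i = k + 1")
    case True
    then show ?thesis
      using P(1) Q(1) by (simp add: z_def r_def tagged_partition_on_def)
  next
    case False
    then have "\<not> i - 1 \<le> k" "i - 1 - k = i - k - 1" "\<not> i \<le> k"
      using that by auto
    then show ?thesis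
      by (simp add: z_def r_def)
  qed
  have cells: "z (i - 1) < z i \<and> r i \<in> {z (i - 1)..z i} \<and> z i - z (i - 1) < \<delta> (r i)"
    if "i \<in> {1..k+l}" for i
  proof (cases "i \<le> k")
    case True
    then have i: "i \<in> {1..k}"
      using that by simp
    then show ?thesis
      using P left[OF i] by (simp add: tagged_partition_on_def fine_partition_def)
  next
    case False
    then have i: "i \<in> {k+1..k+l}" and j: "i - k \<in> {1..l}"
      using that by auto
    have "y (i - k - 1) < y (i - k) \<and> s (i - k) \<in> {y (i - k - 1)..y (i - k)}
        \<and> y (i - k) - y (i - k - 1) < \<delta> (s (i - k))"
      using Q j unfolding tagged_partition_on_def fine_partition_def by blast
    then show ?thesis
      using right[OF i] by simp
  qed
  have "z 0 = u" "z (k + l) = w"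
    using P(1) Q(1) by (auto simp: z_def tagged_partition_on_def)
  then have "tagged_partition_on u w (k + l, z, r)" "fine_partition \<delta> (k + l, z, r)"
    using cells by (auto simp: tagged_partition_on_def fine_partition_def)
  then show ?thesis
    by blast
qed

text \<open>Cousin's lemma by bisection: having a fine partition passes from two adjacent intervals to
  their union, and a nondegenerate interval containing \<open>c\<close> of length less than \<open>\<delta> c\<close> is by
  itself a fine partition with single tag \<open>c\<close>.\<close>

lemma fine_tagged_partition_exists:
  assumes "p \<le> q" and gauge: "gauge_on p q \<delta>"
  shows "\<exists>P. tagged_partition_on p q P \<and> fine_partition \<delta> P"
proof -
  \<comment> \<open>The local condition also covers \<open>u = v = c\<close>, where only the partition with no cells exists.\<close>
  have degenerate: "\<exists>P. tagged_partition_on u u P \<and> fine_partition \<delta> P" for u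
    by (rule exI[of _ "(0, \<lambda>_. u, \<lambda>_. u)"])
       (simp add: tagged_partition_on_def fine_partition_def)
  show ?thesis
    using \<open>p \<le> q\<close>
  proof (induction rule: Bolzano)
    case (trans u v w)
    then obtain k x t l y s where "tagged_partition_on u v (k, x, t)" "fine_partition \<delta> (k, x, t)"
      "tagged_partition_on v w (l, y, s)" "fine_partition \<delta> (l, y, s)"
      by (metis prod_cases3)
    then show ?case
      by (rule fine_tagged_partition_join)
  next
    case (local c)
    have "\<exists>P. tagged_partition_on u v P \<and> fine_partition \<delta> P"
      if "u \<le> c" "c \<le> v" "v - u < \<delta> c" for u v
    proof (cases "u = v")
      case True
      then show ?thesis
        using degenerate by simp
    next
      case False
      then show ?thesis
        using that
        by (intro exI[of _ "(1, \<lambda>i. if i = 0 then u else v, \<lambda>_. c)"])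
           (simp add: tagged_partition_on_def fine_partition_def)
    qed
    moreover have "\<delta> c > 0"
      using gauge local by (simp add: gauge_on_def)
    ultimately show ?case
      by blast
  qed
qed

lemma has_sh_integral_unique:
  assumes "p \<le> q" "has_sh_integral f A p q" "has_sh_integral f B p q"
  shows "A = B"
proof -
  obtain \<delta> where \<delta>: "\<And>n. gauge_on p q (\<delta> n)"
    and A: "\<And>P. (\<And>n. tagged_partition_on p q (P n) \<and> fine_partition (\<delta> n) (P n))
                \<Longrightarrow> (\<lambda>n. riemann_sum f (P n)) \<longlonglongrightarrow> A"
    using assms(2) unfolding has_sh_integral_def by blast
  obtain \<eta> where \<eta>: "\<And>n. gauge_on p q (\<eta> n)"
    and B: "\<And>P. (\<And>n. tagged_partition_on p q (P n) \<and> fine_partition (\<eta> n) (P n))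
                \<Longrightarrow> (\<lambda>n. riemann_sum f (P n)) \<longlonglongrightarrow> B"
    using assms(3) unfolding has_sh_integral_def by blast
  have "gauge_on p q (\<lambda>x. min (\<delta> n x) (\<eta> n x))" for n
    using \<delta>[of n] \<eta>[of n] by (simp add: gauge_on_def)
  then have "\<forall>n. \<exists>P. tagged_partition_on p q P \<and> fine_partition (\<lambda>x. min (\<delta> n x) (\<eta> n x)) P"
    using fine_tagged_partition_exists[OF \<open>p \<le> q\<close>] by blast
  then obtain P where P: "\<And>n. tagged_partition_on p q (P n)"
    "\<And>n. fine_partition (\<lambda>x. min (\<delta> n x) (\<eta> n x)) (P n)"
    by metis
  have "fine_partition (\<delta> n) (P n)" "fine_partition (\<eta> n) (P n)" for n
    using P(2)[of n] by (auto simp: fine_partition_def)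
  then have "(\<lambda>n. riemann_sum f (P n)) \<longlonglongrightarrow> A" "(\<lambda>n. riemann_sum f (P n)) \<longlonglongrightarrow> B"
    using P(1) A B by auto
  then show ?thesis
    by (rule LIMSEQ_unique)
qed

lemma sh_integral_eqI:
  assumes "p < q" "has_sh_integral f A p q"
  shows "sh_integral f p q = A"
  using assms has_sh_integral_unique[of p q f] by (auto simp: sh_integral_def intro!: the_equality)

section \<open>Integrating a derivative\<close>

text \<open>The straddle lemma. Comparing \<open>g\<close> at both ends with its linear approximation at \<open>t\<close> works
  because \<open>t\<close> lies between \<open>u\<close> and \<open>v\<close>: the two errors are proportional to \<open>v - t\<close> and \<open>t - u\<close>,
  which add up to \<open>v - u\<close>.\<close>

lemma derivative_straddle:
  fixes f g :: "real \<Rightarrow> real"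
  assumes "(g has_real_derivative f t) (at t within {p..q})" "e > 0"
  shows "\<exists>d>0. \<forall>u v. u \<in> {p..q} \<longrightarrow> v \<in> {p..q} \<longrightarrow> u \<le> t \<longrightarrow> t \<le> v \<longrightarrow> v - u < d \<longrightarrow>
           \<bar>f t * (v - u) - (g v - g u)\<bar> \<le> e * (v - u)"
proof -
  obtain d where "d > 0" and d: "\<And>y. y \<in> {p..q} \<Longrightarrow> \<bar>y - t\<bar> < d \<Longrightarrow>
      \<bar>g y - g t - f t * (y - t)\<bar> \<le> e * \<bar>y - t\<bar>"
    using assms unfolding has_field_derivative_def has_derivative_within_alt by auto
  have "\<bar>f t * (v - u) - (g v - g u)\<bar> \<le> e * (v - u)"
    if "u \<in> {p..q}" "v \<in> {p..q}" "u \<le> t" "t \<le> v" "v - u < d" for u v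
  proof -
    have "\<bar>g u - g t - f t * (u - t)\<bar> \<le> e * (t - u)" "\<bar>g v - g t - f t * (v - t)\<bar> \<le> e * (v - t)"
      using d[of u] d[of v] that by auto
    then show ?thesis
      by (simp add: algebra_simps abs_le_iff)
  qed
  with \<open>d > 0\<close> show ?thesis
    by blast
qed

lemma riemann_sum_increment_bound:
  assumes "tagged_partition_on p q (k, x, t)"
    and cell: "\<And>i. i \<in> {1..k} \<Longrightarrow>
      \<bar>f (t i) * (x i - x (i - 1)) - (g (x i) - g (x (i - 1)))\<bar> \<le> e * (x i - x (i - 1))"
  shows "\<bar>riemann_sum f (k, x, t) - (g q - g p)\<bar> \<le> e * (q - p)"
proof -
  have telescope: "(\<Sum>i=1..k. h (x i) - h (x (i - 1))) = h q - h p" for h :: "real \<Rightarrow> real"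
    using assms(1) sum_telescope''[of 0 k "\<lambda>i. h (x i)"] by (simp add: tagged_partition_on_def)
  have "riemann_sum f (k, x, t) - (g q - g p)
      = (\<Sum>i=1..k. f (t i) * (x i - x (i - 1)) - (g (x i) - g (x (i - 1))))"
    by (simp add: riemann_sum_def flip: telescope) (simp add: sum_subtractf)
  also have "\<bar>\<dots>\<bar> \<le> (\<Sum>i=1..k. e * (x i - x (i - 1)))"
    by (rule order_trans[OF sum_abs sum_mono]) (rule cell)
  also have "\<dots> = e * (q - p)"
    using telescope[of "\<lambda>y. y"] by (simp flip: sum_distrib_left)
  finally show ?thesis .
qed

text \<open>The \<open>n\<close>-th gauge is the one the straddle lemma supplies for error rate \<open>1 / (n + 1)\<close>.\<close>

theorem has_sh_integral_of_derivative:
  fixes f g :: "real \<Rightarrow> real"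
  assumes deriv: "\<And>t. t \<in> {p..q} \<Longrightarrow> (g has_real_derivative f t) (at t within {p..q})"
  shows "has_sh_integral f (g q - g p) p q"
proof -
  have "\<forall>n t. \<exists>d. t \<in> {p..q} \<longrightarrow> d > 0 \<and>
      (\<forall>u v. u \<in> {p..q} \<longrightarrow> v \<in> {p..q} \<longrightarrow> u \<le> t \<longrightarrow> t \<le> v \<longrightarrow> v - u < d \<longrightarrow>
        \<bar>f t * (v - u) - (g v - g u)\<bar> \<le> inverse (real (Suc n)) * (v - u))"
    using derivative_straddle[of g f _ p q "inverse (real (Suc _))"] deriv by auto
  then obtain \<delta> where \<delta>: "\<And>n t. t \<in> {p..q} \<Longrightarrow> \<delta> n t > 0"
    and straddle: "\<And>n t u v. \<lbrakk>t \<in> {p..q}; u \<in> {p..q}; v \<in> {p..q}; u \<le> t; t \<le> v; v - u < \<delta> n t\<rbrakk>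
      \<Longrightarrow> \<bar>f t * (v - u) - (g v - g u)\<bar> \<le> inverse (real (Suc n)) * (v - u)"
    unfolding choice_iff by blast
  have bound: "\<bar>riemann_sum f P - (g q - g p)\<bar> \<le> inverse (real (Suc n)) * (q - p)"
    if "tagged_partition_on p q P" "fine_partition (\<delta> n) P" for n P
  proof -
    obtain k x t where P: "P = (k, x, t)"
      by (metis prod_cases3)
    have part: "tagged_partition_on p q (k, x, t)"
      using that(1) P by simp
    have "\<bar>f (t i) * (x i - x (i - 1)) - (g (x i) - g (x (i - 1)))\<bar>
        \<le> inverse (real (Suc n)) * (x i - x (i - 1))" if i: "i \<in> {1..k}" for i
    proof (rule straddle)
      show ends: "x (i - 1) \<in> {p..q}" "x i \<in> {p..q}"
        using i tagged_partition_points[OF part, of i] tagged_partition_points[OF part, of "i - 1"]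
        by auto
      show tag: "x (i - 1) \<le> t i" "t i \<le> x i"
        using part i by (auto simp: tagged_partition_on_def)
      show "t i \<in> {p..q}"
        using ends tag by auto
      show "x i - x (i - 1) < \<delta> n (t i)"
        using \<open>fine_partition (\<delta> n) P\<close> P i by (simp add: fine_partition_def)
    qed
    then show ?thesis
      unfolding P by (rule riemann_sum_increment_bound[OF part])
  qed
  have "(\<lambda>n. inverse (real (Suc n)) * (q - p)) \<longlonglongrightarrow> 0 * (q - p)"
    by (intro tendsto_intros LIMSEQ_inverse_real_of_nat)
  then have null: "(\<lambda>n. inverse (real (Suc n)) * (q - p)) \<longlonglongrightarrow> 0"
    by simp
  have "(\<lambda>n. riemann_sum f (P n)) \<longlonglongrightarrow> g q - g p"
    if "\<forall>n. tagged_partition_on p q (P n) \<and> fine_partition (\<delta> n) (P n)" for P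
  proof (rule LIM_zero_cancel, rule Lim_null_comparison[OF _ null])
    show "\<forall>\<^sub>F n in sequentially. norm (riemann_sum f (P n) - (g q - g p))
        \<le> inverse (real (Suc n)) * (q - p)"
      using bound that by simp
  qed
  moreover have "gauge_on p q (\<delta> n)" for n
    using \<delta> by (simp add: gauge_on_def)
  ultimately show ?thesis
    unfolding has_sh_integral_def by blast
qed

section \<open>The fundamental theorem\<close>

theorem theorem10:
  fixes f F :: "real \<Rightarrow> real" and a b :: real
  assumes "a < b"
    and "sh_integrable_on f a b"
    and "\<And>x. x \<in> {a..b} \<Longrightarrow> F x = sh_integral f a x"
    and "continuous_on {a..b} f"
  shows "\<forall>x\<in>{a..b}. (F has_real_derivative f x) (at x within {a..b})"
proof -
  obtain g where g: "\<And>x. x \<in> {a..b} \<Longrightarrow> (g has_real_derivative f x) (at x within {a..b})"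
    using antiderivative_continuous[OF assms(4)]
    by (auto simp: has_real_derivative_iff_has_vector_derivative)
  have F: "F x = g x - g a" if x: "x \<in> {a..b}" for x
  proof (cases "x = a")
    case True
    then show ?thesis
      using assms(3)[OF x] by (simp add: sh_integral_def)
  next
    case False
    have "(g has_real_derivative f t) (at t within {a..x})" if "t \<in> {a..x}" for t
      using x that by (auto intro!: DERIV_subset[OF g])
    then have "has_sh_integral f (g x - g a) a x"
      by (rule has_sh_integral_of_derivative)
    then show ?thesis
      using False x assms(3)[OF x] by (simp add: sh_integral_eqI)
  qed
  show ?thesis
  proof
    fix x assume x: "x \<in> {a..b}"
    have "((\<lambda>y. g y - g a) has_real_derivative f x) (at x within {a..b})"
      using DERIV_diff[OF g[OF x] DERIV_const] by simp
    then show "(F has_real_derivative f x) (at x within {a..b})"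
      by (rule has_field_derivative_transform_within[OF _ zero_less_one x]) (simp add: F)
  qed
qed

end
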